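(* Let $Q$ be a probability distribution supported on the set $\{1,2\}$, with $Q(1)>0$. (i) The compound Poisson distribution $\mathrm{CPo}(\lambda,Q)$ is log-concave for all $\lambda>0$ with $\lambda\ge \frac{2Q(2)}{Q(1)^2}$. (ii) Let $P$ be an ultra log-concave distribution with support $\{0,1,\ldots,N\}$, where $N$ may be infinite (in which case the support is all of $\mathbb{Z}_+$), such that $$\frac{(x+1)P(x+1)}{P(x)}\ge \frac{2Q(2)}{Q(1)^2}\qquad\text{for all integers } x \text{ with } 0\le x<N.$$ Then $C_QP$ is log-concave.
   Context: All distributions are probability mass functions on $\mathbb{Z}_+=\{0,1,2,\ldots\}$; a distribution on $\mathbb{N}=\{1,2,\ldots\}$ is regarded as a distribution on $\mathbb{Z}_+$ with mass $0$ at $0$. A distribution $P$ on $\mathbb{Z}_+$ is log-concave if its support is a (possibly infinite) interval of successive integers and $P(x)^2\ge P(x+1)P(x-1)$ for all $x\ge 1$. It is ultra log-concave if its support is a (possibly infinite) interval of successive integers and $xP(x)^2\ge (x+1)P(x+1)P(x-1)$ for all $x\ge 1$. For a distribution $P$ on $\mathbb{Z}_+$ and a distribution $Q$ on $\mathbb{N}$, $C_QP(x)=\sum_{y=0}^\infty P(y)Q^{*y}(x)$, $x\ge 0$, where $Q^{*y}$ is the $y$-th convolution power of $Q$ and $Q^{*0}$ is the point mass at $0$. With $\Pi_\lambda(x)=e^{-\lambda}\lambda^x/x!$, $\mathrm{CPo}(\lambda,Q)$ is the distribution $C_Q\Pi_\lambda$. *)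

theory Defs
  imports "HOL-Probability.Probability" "HOL-Library.Extended_Nat"
begin

definition is_nat_interval :: "nat set \<Rightarrow> bool" where
  "is_nat_interval S \<longleftrightarrow> (\<forall>a\<in>S. \<forall>b\<in>S. {a..b} \<subseteq> S)"

definition log_concave :: "nat pmf \<Rightarrow> bool" where
  "log_concave P \<longleftrightarrow> is_nat_interval (set_pmf P) \<and>
     (\<forall>x\<ge>1. (pmf P x)\<^sup>2 \<ge> pmf P (x + 1) * pmf P (x - 1))"

definition ultra_log_concave :: "nat pmf \<Rightarrow> bool" where
  "ultra_log_concave P \<longleftrightarrow> is_nat_interval (set_pmf P) \<and>
     (\<forall>x\<ge>1. real x * (pmf P x)\<^sup>2 \<ge> real (x + 1) * pmf P (x + 1) * pmf P (x - 1))"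

definition conv_pmf :: "nat pmf \<Rightarrow> nat pmf \<Rightarrow> nat pmf" where
  "conv_pmf A B = map_pmf (\<lambda>(a, b). a + b) (pair_pmf A B)"

primrec conv_power :: "nat pmf \<Rightarrow> nat \<Rightarrow> nat pmf" where
  "conv_power Q 0 = return_pmf 0"
| "conv_power Q (Suc y) = conv_pmf Q (conv_power Q y)"

(* The mixture of the convolution powers of Q with weights P; its mass function is the series
   in pmf_compound below. *)
definition compound :: "nat pmf \<Rightarrow> nat pmf \<Rightarrow> nat pmf" where
  "compound Q P = bind_pmf P (conv_power Q)"

(* poisson_pmf has its Poisson mass function (pmf_poisson) only for l > 0. *)
definition compound_poisson :: "real \<Rightarrow> nat pmf \<Rightarrow> nat pmf" where
  "compound_poisson l Q = compound Q (poisson_pmf l)"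

lemma pmf_conv_pmf: "pmf (conv_pmf A B) x = (\<Sum>k\<le>x. pmf A k * pmf B (x - k))"
proof -
  have inj: "inj_on (\<lambda>k. (k, x - k)) {..x}"
    by (auto simp: inj_on_def)
  have eq: "(\<lambda>(a, b). a + b) -` {x} = (\<lambda>k. (k, x - k)) ` {..x}"
    by (force simp: image_iff)
  have "pmf (conv_pmf A B) x = measure_pmf.prob (pair_pmf A B) ((\<lambda>k. (k, x - k)) ` {..x})"
    by (simp add: conv_pmf_def pmf_map eq)
  also have "\<dots> = (\<Sum>p\<in>(\<lambda>k. (k, x - k)) ` {..x}. pmf (pair_pmf A B) p)"
    by (rule measure_measure_pmf_finite) simp
  also have "\<dots> = (\<Sum>k\<le>x. pmf A k * pmf B (x - k))"
    by (simp add: sum.reindex[OF inj] pmf_pair)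
  finally show ?thesis .
qed

lemma pmf_compound:
  "(\<lambda>y. pmf P y * pmf (conv_power Q y) x) sums pmf (compound Q P) x"
proof -
  let ?f = "\<lambda>y. pmf P y * pmf (conv_power Q y) x"
  have int: "integrable (count_space UNIV) ?f"
    by (rule Bochner_Integration.integrable_bound[OF integrable_pmf[of UNIV P]])
       (auto simp: abs_mult intro!: mult_left_le pmf_le_1)
  have "pmf (compound Q P) x = (\<integral>y. ?f y \<partial>count_space UNIV)"
    by (simp add: compound_def pmf_bind measure_pmf_eq_density integral_density)
  with sums_integral_count_space_nat[OF int] show ?thesis by simp
qed

end

theory Submission
  imports Defs
begin

text \<open>
  Write \<open>P(y) = a(y) / y!\<close>, so that ultra log-concavity of \<open>P\<close> is log-concavity of \<open>a\<close>, and
  let \<open>F(w) = \<Sum>y. a(y) w^y / y!\<close>.  With \<open>p = Q(1)\<close> and \<open>r = Q(2)\<close>, the mass function \<open>c\<close> of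
  \<open>C\<^sub>QP\<close> has generating function \<open>F(p z + r z^2)\<close>.  Differentiating gives
  \<open>x c(x) = p c'(x - 1) + 2 r c'(x - 2)\<close>, where \<open>c'\<close> comes from the shifted sequence
  \<open>a'(y) = a(y + 1)\<close>.  Put \<open>D(x) = c(x)^2 - c(x + 1) c(x - 1)\<close>, and \<open>D'\<close> likewise for \<open>c'\<close>.
  The recurrence yields
  \<open>(x + 1) D(x) = c(x)^2 + p (c(x) c'(x - 1) - c'(x) c(x - 1)) - 2 r G(x)\<close> with
  \<open>G(x) = c'(x - 1) c(x - 1) - c(x) c'(x - 2)\<close> and \<open>x G(x) = c'(x - 1) c(x - 1) - 2 r D'(x - 2)\<close>.
  The bracket is nonnegative since compounding preserves monotone likelihood ratios, \<open>D'(x - 2)\<close>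
  is nonnegative by induction, and \<open>2 r c(x - 1) \<le> p x c(x)\<close>, which holds unless \<open>c(x + 1) = 0\<close> and
  is where the lower bound on the ratios of \<open>a\<close> enters, then gives \<open>2 r G(x) \<le> c(x)^2\<close>.
\<close>

section \<open>Generating-function coefficients and their order properties\<close>

text \<open>\<open>mix p r a x\<close> is the coefficient of \<open>z^x\<close> in
  \<open>F(p z + r z^2)\<close>, as \<open>mix_eq_sum\<close> confirms. The recursion passes to the
  shift of \<open>a\<close>, which is why the inductions below keep \<open>a\<close>
  arbitrary.\<close>

fun mix :: "real \<Rightarrow> real \<Rightarrow> (nat \<Rightarrow> real) \<Rightarrow> nat \<Rightarrow> real" where
  "mix p r a 0 = a 0"
| "mix p r a (Suc 0) = p * a 1"
| "mix p r a (Suc (Suc x)) =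
     (p * mix p r (\<lambda>y. a (Suc y)) (Suc x) + 2 * r * mix p r (\<lambda>y. a (Suc y)) x) / real (x + 2)"

lemma mix_rec:
  "real (x + 2) * mix p r a (Suc (Suc x)) =
     p * mix p r (\<lambda>y. a (Suc y)) (Suc x) + 2 * r * mix p r (\<lambda>y. a (Suc y)) x"
  by (simp only: mix.simps) (simp add: field_simps)

declare mix.simps(3) [simp del]

context
  fixes p r :: real
  assumes p: "p > 0" and r: "r \<ge> 0"
begin

text \<open>\<open>mix\<close> is linear in \<open>a\<close> with nonnegative weights. The factors
  \<open>s\<close> and \<open>t\<close> allow ratios to be compared without division.\<close>

lemma mix_scaled_mono:
  assumes "\<And>y. s * b y \<le> t * a y"
  shows "s * mix p r b x \<le> t * mix p r a x"
  using assms
proof (induction x arbitrary: a b rule: induct_nat_012)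
  case 0
  then show ?case by simp
next
  case 1
  from mult_left_mono[OF 1[of 1], of p] p show ?case
    by (simp add: mult.left_commute)
next
  case (ge2 x)
  let ?a = "\<lambda>y. a (Suc y)" and ?b = "\<lambda>y. b (Suc y)"
  have "real (x + 2) * (s * mix p r b (Suc (Suc x)))
      = p * (s * mix p r ?b (Suc x)) + 2 * r * (s * mix p r ?b x)"
    using arg_cong[OF mix_rec[of x p r b], of "\<lambda>z. s * z"] by (simp add: algebra_simps)
  also have "\<dots> \<le> p * (t * mix p r ?a (Suc x)) + 2 * r * (t * mix p r ?a x)"
    using p r ge2.prems by (intro add_mono mult_left_mono ge2.IH) auto
  also have "\<dots> = real (x + 2) * (t * mix p r a (Suc (Suc x)))"
    using arg_cong[OF mix_rec[of x p r a], of "\<lambda>z. t * z"] by (simp add: algebra_simps)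
  finally show ?case by (simp add: mult_le_cancel_left)
qed

lemma mix_nonneg: "(\<And>y. a y \<ge> 0) \<Longrightarrow> mix p r a x \<ge> 0"
  using mix_scaled_mono[of 0 a 1 a x] by simp

text \<open>Multiplying the recurrences at \<open>x\<close> and \<open>z\<close> gives four
  products, each controlled by induction for the shifted sequences. For \<open>x < 2\<close>,
  \<open>mix\<close> is a multiple of a single entry, so \<open>mix_scaled_mono\<close>
  suffices.\<close>

lemma mix_likelihood_ratio:
  assumes "\<And>y. a y \<ge> 0" "\<And>y. b y \<ge> 0"
    and "\<And>i j. i \<le> j \<Longrightarrow> a i * b j \<le> a j * b i"
    and "x \<le> z"
  shows "mix p r a x * mix p r b z \<le> mix p r a z * mix p r b x"
  using assms
proof (induction x arbitrary: a b z rule: induct_nat_012)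
  case 0
  then show ?case
    using mix_scaled_mono[of "a 0" b "b 0" a z] by (simp add: mult.commute)
next
  case 1
  show ?case
  proof (cases "z = 1")
    case False
    define w where "w = z - 2"
    from False 1(4) have z: "z = Suc (Suc w)" by (simp add: w_def)
    let ?a = "\<lambda>y. a (Suc y)" and ?b = "\<lambda>y. b (Suc y)"
    have *: "a 1 * mix p r ?b v \<le> b 1 * mix p r ?a v" for v
    proof (rule mix_scaled_mono)
      show "a 1 * b (Suc y) \<le> b 1 * a (Suc y)" for y
        using 1(3)[of 1 "Suc y"] by (simp add: mult.commute)
    qed
    have "real (w + 2) * (a 1 * mix p r b z) = p * (a 1 * mix p r ?b (Suc w)) 
        + 2 * r * (a 1 * mix p r ?b w)"
      using arg_cong[OF mix_rec[of w p r b], of "\<lambda>v. a 1 * v"] by (simp add: z algebra_simps)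
    also have "\<dots> \<le> p * (b 1 * mix p r ?a (Suc w)) + 2 * r * (b 1 * mix p r ?a w)"
      using p r by (intro add_mono mult_left_mono *) auto
    also have "\<dots> = real (w + 2) * (b 1 * mix p r a z)"
      using arg_cong[OF mix_rec[of w p r a], of "\<lambda>v. b 1 * v"] by (simp add: z algebra_simps)
    finally have "a 1 * mix p r b z \<le> b 1 * mix p r a z" by (simp add: mult_le_cancel_left)
    from mult_left_mono[OF this, of p] p show ?thesis by (simp add: algebra_simps)
  qed simp
next
  case (ge2 x)
  show ?case
  proof (cases "z = Suc (Suc x)")
    case False
    define w where "w = z - 2"
    \<comment> \<open>Excluding equality yields \<open>Suc x \<le> w\<close>, the order that the
      cross term \<open>?A (Suc x) * ?B w\<close> needs.\<close>
    from False ge2.prems(4) have z: "z = Suc (Suc w)" and w: "Suc x \<le> w"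
      by (simp_all add: w_def)
    let ?A = "mix p r (\<lambda>y. a (Suc y))" and ?B = "mix p r (\<lambda>y. b (Suc y))"
    have lr: "?A i * ?B j \<le> ?A j * ?B i" if "i \<in> {x, Suc x}" "i \<le> j" for i j
      using that ge2.prems ge2.IH[of "\<lambda>y. a (Suc y)" "\<lambda>y. b (Suc y)" j] by auto
    have "(real (x + 2) * mix p r a (Suc (Suc x))) * (real (w + 2) * mix p r b z)
        = p\<^sup>2 * (?A (Suc x) * ?B (Suc w)) + 2 * r * p * (?A (Suc x) * ?B w)
          + 2 * r * p * (?A x * ?B (Suc w)) + (2 * r)\<^sup>2 * (?A x * ?B w)"
      unfolding z mix_rec by (simp add: algebra_simps power2_eq_square)
    also have "\<dots> \<le> p\<^sup>2 * (?A (Suc w) * ?B (Suc x)) + 2 * r * p * (?A w * ?B (Suc x))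
          + 2 * r * p * (?A (Suc w) * ?B x) + (2 * r)\<^sup>2 * (?A w * ?B x)"
      using p r w by (intro add_mono mult_left_mono lr) auto
    also have "\<dots> = (real (w + 2) * mix p r a z) * (real (x + 2) * mix p r b (Suc (Suc x)))"
      unfolding z mix_rec by (simp add: algebra_simps power2_eq_square)
    finally have "(real (x + 2) * real (w + 2)) * (mix p r a (Suc (Suc x)) * mix p r b z)
        \<le> (real (x + 2) * real (w + 2)) * (mix p r a z * mix p r b (Suc (Suc x)))"
      by (simp only: mult_ac)
    then show ?thesis by (subst (asm) mult_le_cancel_left_pos) auto
  qed simp
qed

text \<open>The recurrence lowers \<open>x\<close> by two per shift of \<open>a\<close>, so only the middle ratio of \<open>a\<close> matters,
  and for odd \<open>x\<close> none.\<close>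

lemma mix_growth:
  assumes "\<And>y. a y \<ge> 0"
    and "even x \<Longrightarrow> 2 * r * a (x div 2) \<le> p\<^sup>2 * a (Suc (x div 2))"
  shows "2 * r * mix p r a x \<le> p * (real (Suc x) * mix p r a (Suc x))"
  using assms
proof (induction x arbitrary: a rule: induct_nat_012)
  case 0
  then show ?case by (simp add: power2_eq_square)
next
  case 1
  have "p * (real (0 + 2) * mix p r a (Suc (Suc 0))) = p\<^sup>2 * (p * a 2) + 2 * r * (p * a 1)"
    unfolding mix_rec by (simp add: algebra_simps power2_eq_square numeral_2_eq_2)
  with 1 p show ?case by simp
next
  case (ge2 x)
  let ?A = "mix p r (\<lambda>y. a (Suc y))"
  have nn: "?A v \<ge> 0" for v
    using ge2.prems(1) by (intro mix_nonneg) auto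
  have IH: "2 * r * ?A x \<le> p * (real (Suc x) * ?A (Suc x))"
    using ge2.prems by (intro ge2.IH(1)) auto
  have "real (x + 2) * (2 * r * mix p r a (Suc (Suc x)))
      = 2 * r * (p * ?A (Suc x) + 2 * r * ?A x)"
    using mix_rec[of x p r a] by (simp add: mult_ac)
  \<comment> \<open>The induction hypothesis turns the second term into \<open>Suc x\<close> copies
    of the first, which produces the factor \<open>x + 2\<close>.\<close>
  also have "\<dots> \<le> 2 * r * (p * ?A (Suc x) + p * (real (Suc x) * ?A (Suc x)))"
    using IH r by (intro mult_left_mono add_left_mono) auto
  also have "\<dots> = real (x + 2) * (p * (2 * r * ?A (Suc x)))"
    by (simp add: algebra_simps)
  also have "\<dots> \<le> real (x + 2) * (p * (p * ?A (Suc (Suc x)) + 2 * r * ?A (Suc x)))"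
    using nn p by (intro mult_left_mono) auto
  also have "\<dots> = real (x + 2) * (p * (real (Suc x + 2) * mix p r a (Suc (Suc (Suc x)))))"
    unfolding mix_rec ..
  finally have "2 * r * mix p r a (Suc (Suc x)) \<le> p * (real (Suc x + 2) * mix p r a (Suc (Suc (Suc x))))"
    by (subst (asm) mult_le_cancel_left_pos) auto
  then show ?case by (simp add: algebra_simps)
qed

section \<open>Support and log-concavity of the coefficients\<close>

text \<open>\<open>(p z + r z^2)^y\<close> has degree at most \<open>2 * y\<close>, so only entries
  \<open>a y\<close> with \<open>x \<le> 2 * y\<close> contribute.\<close>

lemma mix_eq_0:
  assumes "\<And>y. x \<le> 2 * y \<Longrightarrow> a y = 0"
  shows "mix p r a x = 0"
  using assms by (induction x arbitrary: a rule: induct_nat_012) (auto simp: mix.simps(3))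

text \<open>For \<open>x = Suc w\<close>, positivity at \<open>Suc x\<close> makes the shifted
  sequence positive at \<open>Suc w\<close> or at \<open>w\<close>, hence at \<open>w\<close> by
  induction; the \<open>p\<close> term carries this to \<open>x\<close>.\<close>

lemma mix_support_down:
  assumes "\<And>y. a y \<ge> 0" "\<And>y. a (Suc y) > 0 \<Longrightarrow> a y > 0" "mix p r a (Suc x) > 0"
  shows "mix p r a x > 0"
  using assms
proof (induction x arbitrary: a rule: less_induct)
  case (less x)
  show ?case
  proof (cases x)
    case 0
    with less.prems(2)[of 0] less.prems(3) p show ?thesis by (simp add: zero_less_mult_iff)
  next
    case (Suc w)
    let ?A = "mix p r (\<lambda>y. a (Suc y))"
    have nn: "?A v \<ge> 0" for v
      using less.prems(1) by (intro mix_nonneg) auto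
    have "p * ?A (Suc w) + 2 * r * ?A w > 0"
      using less.prems(3) unfolding Suc mix_rec[symmetric] by (simp add: zero_less_mult_iff)
    moreover have "?A w > 0" if "?A (Suc w) > 0"
      by (rule less.IH[of w "\<lambda>y. a (Suc y)", OF _ less.prems(1) less.prems(2) that]) (simp_all add: Suc)
    ultimately have A: "?A w > 0"
      using nn[of w] p by (cases "?A w = 0") (simp_all add: zero_less_mult_iff)
    show ?thesis
    proof (cases w)
      case 0
      with A p show ?thesis by (simp add: Suc)
    next
      case (Suc v)
      have "real (v + 2) * mix p r a (Suc (Suc v)) > 0"
        unfolding mix_rec using A p r nn[of v] by (intro add_pos_nonneg) (auto simp: Suc)
      then show ?thesis by (simp add: \<open>x = Suc w\<close> Suc zero_less_mult_iff)
    qed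
  qed
qed

text \<open>The second hypothesis is log-concavity as a likelihood-ratio order between
  \<open>a\<close> and its shift, as \<open>mix_likelihood_ratio\<close> expects. All four
  hypotheses survive shifting \<open>a\<close>.\<close>

lemma mix_log_concave:
  assumes "\<And>y. a y \<ge> 0"
    and "\<And>i j. i \<le> j \<Longrightarrow> a i * a (Suc j) \<le> a j * a (Suc i)"
    and "\<And>y. a (Suc y) > 0 \<Longrightarrow> a y > 0"
    and "\<And>y. a (Suc y) > 0 \<Longrightarrow> 2 * r * a y \<le> p\<^sup>2 * a (Suc y)"
  shows "mix p r a (Suc (Suc x)) * mix p r a x \<le> (mix p r a (Suc x))\<^sup>2"
  using assms
proof (induction x arbitrary: a rule: less_induct)
  case (less x)
  note prems = less.prems
  let ?C = "mix p r a" and ?A = "mix p r (\<lambda>y. a (Suc y))"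
  have C: "?C v \<ge> 0" and A: "?A v \<ge> 0" for v
    using prems(1) by (auto intro!: mix_nonneg)
  show ?case
  \<comment> \<open>Only here can \<open>growth\<close> fail; but then \<open>a\<close> vanishes
    from \<open>Suc (x div 2)\<close> on, which forces \<open>?C (Suc (Suc x)) = 0\<close>.\<close>
  proof (cases "even x \<and> a (Suc (x div 2)) = 0")
    case True
    have "a y = 0" if "Suc (x div 2) \<le> y" for y
      using that
    proof (induction y rule: dec_induct)
      case (step n)
      then show ?case using prems(1)[of "Suc n"] prems(3)[of n] by force
    qed (use True in auto)
    then have "?C (Suc (Suc x)) = 0" by (intro mix_eq_0) auto
    then show ?thesis by simp
  next
    case False
    have "2 * r * a (x div 2) \<le> p\<^sup>2 * a (Suc (x div 2))" if "even x"
      using False that prems(1)[of "Suc (x div 2)"] by (intro prems(4)) auto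
    then have growth: "2 * r * ?C x \<le> p * (real (Suc x) * ?C (Suc x))"
      using prems(1) by (intro mix_growth) auto
    have lr: "?C x * ?A (Suc x) \<le> ?C (Suc x) * ?A x"
      using prems(1) by (intro mix_likelihood_ratio prems(2)) auto
    \<comment> \<open>The index \<open>x\<close> of the overview is \<open>Suc x\<close> here. The
      value 0 at negative indices makes \<open>rec1\<close> and \<open>rec0\<close> hold for every
      \<open>x\<close>.\<close>
    define L M where "L = (if x = 0 then 0 else ?A (x - 1))"
      and "M = (if x \<le> 1 then 0 else ?A (x - 2))"
    have D: "?A x * M \<le> L\<^sup>2"
    proof (cases "x \<le> 1")
      case False
      define w where "w = x - 2"
      from False have x: "x = Suc (Suc w)" by (simp add: w_def)
      have "?A (Suc (Suc w)) * ?A w \<le> (?A (Suc w))\<^sup>2"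
        by (rule less.IH[of w "\<lambda>y. a (Suc y)", OF _ prems(1) prems(2) prems(3) prems(4)]) (simp_all add: x)
      then show ?thesis by (simp add: x L_def M_def)
    qed (simp add: M_def)
    have rec1: "real (Suc x) * ?C (Suc x) = p * ?A x + 2 * r * L"
      using mix_rec[of "x - 1" p r a] by (cases x) (auto simp: L_def)
    have rec0: "real x * ?C x = p * L + 2 * r * M"
      using mix_rec[of "x - 2" p r a] by (cases x; cases "x - 1") (auto simp: L_def M_def)
    have rec2: "real (x + 2) * ?C (Suc (Suc x)) = p * ?A (Suc x) + 2 * r * ?A x"
      by (rule mix_rec)
    define G where "G = ?A x * ?C x - ?C (Suc x) * L"
    have "real (Suc x) * G = ?A x * ?C x + ?A x * (real x * ?C x) - (real (Suc x) * ?C (Suc x)) * L"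
      by (simp add: G_def algebra_simps)
    also have "\<dots> = ?A x * ?C x - 2 * r * (L\<^sup>2 - ?A x * M)"
      unfolding rec0 rec1 by (simp add: algebra_simps power2_eq_square)
    also have "\<dots> \<le> ?A x * ?C x"
      using D r by simp
    finally have G: "real (Suc x) * G \<le> ?A x * ?C x" .
    \<comment> \<open>The bound \<open>G\<close> serves twice: with \<open>growth\<close> it bounds
      \<open>2 * r * (?A x * ?C x)\<close> through \<open>rec1\<close>, and that bound fed back into
      it gives \<open>key\<close>.\<close>
    have "real (Suc x) * (2 * r * G) \<le> 2 * r * (?A x * ?C x)"
      using mult_left_mono[OF G, of "2 * r"] r by (simp add: mult_ac)
    also have "\<dots> \<le> ?A x * (p * (real (Suc x) * ?C (Suc x)))"
      using mult_left_mono[OF growth A[of x]] by (simp add: mult_ac)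
    also have "\<dots> = real (Suc x) * (p * ?A x * ?C (Suc x))" by simp
    finally have "2 * r * G \<le> p * ?A x * ?C (Suc x)"
      by (subst (asm) mult_le_cancel_left_pos) auto
    then have "2 * r * (?A x * ?C x) \<le> (p * ?A x + 2 * r * L) * ?C (Suc x)"
      by (simp add: G_def algebra_simps)
    also have "\<dots> = real (Suc x) * (?C (Suc x))\<^sup>2"
      unfolding rec1[symmetric] by (simp add: power2_eq_square)
    finally have "real (Suc x) * (2 * r * G) \<le> real (Suc x) * (?C (Suc x))\<^sup>2"
      using mult_left_mono[OF G, of "2 * r"] r by (simp add: mult_ac)
    then have key: "2 * r * G \<le> (?C (Suc x))\<^sup>2"
      by (subst (asm) mult_le_cancel_left_pos) auto
    have "real (x + 2) * (?C (Suc (Suc x)) * ?C x) = p * (?C x * ?A (Suc x)) + 2 * r * (?A x * ?C x)"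
      using rec2 by (simp add: algebra_simps)
    also have "\<dots> \<le> p * (?C (Suc x) * ?A x) + ((?C (Suc x))\<^sup>2 + 2 * r * (?C (Suc x) * L))"
    proof (rule add_mono)
      show "p * (?C x * ?A (Suc x)) \<le> p * (?C (Suc x) * ?A x)"
        using lr p by (intro mult_left_mono) auto
      show "2 * r * (?A x * ?C x) \<le> (?C (Suc x))\<^sup>2 + 2 * r * (?C (Suc x) * L)"
        using key by (simp add: G_def algebra_simps)
    qed
    also have "\<dots> = (?C (Suc x))\<^sup>2 + (p * ?A x + 2 * r * L) * ?C (Suc x)"
      by (simp add: algebra_simps)
    also have "\<dots> = real (x + 2) * (?C (Suc x))\<^sup>2"
      unfolding rec1[symmetric] by (simp add: algebra_simps power2_eq_square)
    finally show ?thesis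
      by (subst (asm) mult_le_cancel_left_pos) auto
  qed
qed

end

section \<open>Closed form of the recurrence by polynomial powers\<close>

lemma coeff_power_eq_0:
  fixes y :: nat
  shows "x < y \<Longrightarrow> coeff ([:0, p, r:] ^ y) x = (0 :: real)"
proof (induction y arbitrary: x)
  case (Suc y)
  show ?case
  proof (cases x)
    case (Suc w)
    have "coeff ([:0, p, r:] ^ Suc y) x = p * coeff ([:0, p, r:] ^ y) w 
        + coeff (pCons 0 (smult r ([:0, p, r:] ^ y))) w"
      by (simp add: Suc)
    also have "\<dots> = 0"
      using Suc Suc.prems Suc.IH[of w] Suc.IH[of "w - 1"] by (cases w) auto
    finally show ?thesis .
  qed simp
qed simp

text \<open>Differentiating \<open>?q ^ Suc y\<close> reproduces the recurrence. The upper limit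
  \<open>n\<close> is left free because one shift lowers it by one but the index by up to
  two.\<close>

lemma mix_eq_sum:
  assumes "x \<le> n"
  shows "(\<Sum>y\<le>n. a y / fact y * coeff ([:0, p, r:] ^ y) x) = mix p r a x"
  using assms
proof (induction x arbitrary: a n rule: induct_nat_012)
  case 0
  have "coeff ([:0, p, r:] ^ y) 0 = (if y = 0 then 1 else 0)" for y :: nat
    by (cases y) auto
  then show ?case by (simp add: if_distrib[of "\<lambda>v. _ * v"] cong: if_cong)
next
  case 1
  have "coeff ([:0, p, r:] ^ y) (Suc 0) = (if y = 1 then p else 0)" for y :: nat
    by (cases "y \<le> 1") (auto simp: le_Suc_eq coeff_power_eq_0)
  with 1 show ?case by (simp add: if_distrib[of "\<lambda>v. _ * v"] cong: if_cong)
next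
  case (ge2 x)
  then obtain m where n: "n = Suc m" and m: "Suc x \<le> m"
    by (metis Suc_le_D Suc_le_mono)
  let ?q = "[:0, p, r:] :: real poly"
  have der: "real (x + 2) * coeff (?q ^ Suc y) (Suc (Suc x))
      = real (Suc y) * (p * coeff (?q ^ y) (Suc x) + 2 * r * coeff (?q ^ y) x)" for y
  proof -
    have "real (x + 2) * coeff (?q ^ Suc y) (Suc (Suc x)) = coeff (pderiv (?q ^ Suc y)) (Suc x)"
      by (simp add: coeff_pderiv del: power_Suc)
    also have "pderiv (?q ^ Suc y) = smult (real (Suc y)) (?q ^ y * [:p, 2 * r:])"
      by (simp only: pderiv_power_Suc) (simp add: pderiv_pCons smult_add_right mult_ac)
    also have "coeff \<dots> (Suc x) = real (Suc y) * (p * coeff (?q ^ y) (Suc x) + 2 * r * coeff (?q ^ y) x)"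
      by simp
    finally show ?thesis .
  qed
  \<comment> \<open>The summand \<open>y = 0\<close> drops out, since \<open>?q ^ 0\<close> is
    constant.\<close>
  have "real (x + 2) * (\<Sum>y\<le>n. a y / fact y * coeff (?q ^ y) (Suc (Suc x)))
      = (\<Sum>y\<le>m. a (Suc y) / fact (Suc y) * (real (x + 2) * coeff (?q ^ Suc y) (Suc (Suc x))))"
    by (simp add: n sum.atMost_Suc_shift sum_distrib_left mult_ac del: power_Suc sum.atMost_Suc fact_Suc)
  also have "\<dots> = (\<Sum>y\<le>m. p * (a (Suc y) / fact y * coeff (?q ^ y) (Suc x))
                         + 2 * r * (a (Suc y) / fact y * coeff (?q ^ y) x))"
    unfolding der by (intro sum.cong refl) (simp add: field_simps del: of_nat_Suc)
  also have "\<dots> = p * mix p r (\<lambda>y. a (Suc y)) (Suc x) + 2 * r * mix p r (\<lambda>y. a (Suc y)) x"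
    unfolding sum.distrib sum_distrib_left[symmetric]
    using m ge2.IH(1)[of m "\<lambda>y. a (Suc y)"] ge2.IH(2)[of m "\<lambda>y. a (Suc y)"] by simp
  also have "\<dots> = real (x + 2) * mix p r a (Suc (Suc x))"
    by (rule mix_rec[symmetric])
  finally show ?case by (subst (asm) mult_cancel_left) simp
qed

section \<open>Compounding with a distribution on 1 and 2\<close>

context
  fixes Q :: "nat pmf"
  assumes Q: "set_pmf Q \<subseteq> {1, 2}"
begin

text \<open>The polynomial is the probability generating function of \<open>Q\<close>, and
  convolution is polynomial multiplication.\<close>

lemma pmf_conv_power_eq_coeff:
  "pmf (conv_power Q y) x = coeff ([:0, pmf Q 1, pmf Q 2:] ^ y) x"
proof (induction y arbitrary: x)
  case 0
  then show ?case by (cases x) auto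
next
  case (Suc y)
  have "coeff [:0, pmf Q 1, pmf Q 2:] k = pmf Q k" for k
  proof (cases "k \<in> {1, 2}")
    case False
    then have "pmf Q k = 0" using Q by (auto simp: pmf_eq_0_set_pmf)
    with False show ?thesis by (auto simp: coeff_pCons split: nat.split)
  qed (auto simp: numeral_2_eq_2)
  then show ?case by (simp only: conv_power.simps power_Suc pmf_conv_pmf coeff_mult Suc)
qed

lemma pmf_compound_eq_mix:
  "pmf (compound Q P) x = mix (pmf Q 1) (pmf Q 2) (\<lambda>y. pmf P y * fact y) x"
proof -
  have "(\<lambda>y. pmf P y * pmf (conv_power Q y) x) sums
      (\<Sum>y\<le>x. pmf P y * pmf (conv_power Q y) x)"
    by (intro sums_finite) (auto simp: pmf_conv_power_eq_coeff coeff_power_eq_0)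
  then have "pmf (compound Q P) x = (\<Sum>y\<le>x. pmf P y * pmf (conv_power Q y) x)"
    using pmf_compound[of P Q x] sums_unique2 by blast
  then show ?thesis
    using mix_eq_sum[of x x "\<lambda>y. pmf P y * fact y" "pmf Q 1" "pmf Q 2"]
    by (simp add: pmf_conv_power_eq_coeff)
qed

lemma log_concave_compound:
  assumes Q1: "pmf Q 1 > 0" and P: "ultra_log_concave P" and N: "set_pmf P = {x. enat x \<le> N}"
    and ratio: "\<And>x. enat x < N \<Longrightarrow>
      real (x + 1) * pmf P (x + 1) / pmf P x \<ge> 2 * pmf Q 2 / (pmf Q 1)\<^sup>2"
  shows "log_concave (compound Q P)"
proof -
  let ?a = "\<lambda>y. pmf P y * fact y"
  have pos: "?a y > 0 \<longleftrightarrow> enat y \<le> N" for y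
    using N by (auto simp: zero_less_mult_iff pmf_positive_iff)
  have nonneg: "?a y \<ge> 0" for y by simp
  have down: "?a y > 0" if "?a (Suc y) > 0" for y
    using that unfolding pos by (cases N) auto
  have lc: "?a (Suc (Suc y)) * ?a y \<le> (?a (Suc y))\<^sup>2" for y
  proof -
    have "real (y + 2) * pmf P (y + 2) * pmf P y \<le> real (y + 1) * (pmf P (y + 1))\<^sup>2"
      using P[unfolded ultra_log_concave_def] by (auto dest!: spec[of _ "Suc y"])
    then have "(fact (Suc y) * fact y) * (real (y + 2) * pmf P (y + 2) * pmf P y)
        \<le> (fact (Suc y) * fact y) * (real (y + 1) * (pmf P (y + 1))\<^sup>2)"
      by (intro mult_left_mono) auto
    then show ?thesis by (simp add: power2_eq_square algebra_simps)
  qed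
  \<comment> \<open>Consecutive inequalities are chained by cancelling \<open>?a j\<close>; if it is
    0, so is \<open>?a (Suc (Suc j))\<close>, because the support is an initial segment.\<close>
  have lr: "?a i * ?a (Suc j) \<le> ?a j * ?a (Suc i)" if "i \<le> j" for i j
    using that
  proof (induction j rule: dec_induct)
    case (step j)
    show ?case
    proof (cases "?a j > 0")
      case True
      have "?a j * (?a i * ?a (Suc (Suc j))) \<le> ?a i * (?a (Suc j))\<^sup>2"
        using mult_left_mono[OF lc[of j] nonneg[of i]] by (simp only: mult_ac)
      also have "\<dots> \<le> ?a j * (?a (Suc j) * ?a (Suc i))"
        using mult_right_mono[OF step.IH nonneg[of "Suc j"]] by (simp only: mult_ac power2_eq_square)
      finally show ?thesis using True by (subst (asm) mult_le_cancel_left_pos)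
    next
      case False
      with down[of "Suc j"] down[of j] have "\<not> ?a (Suc (Suc j)) > 0" by blast
      with nonneg[of "Suc (Suc j)"] have "?a (Suc (Suc j)) = 0" by linarith
      then show ?thesis using nonneg[of "Suc j"] nonneg[of "Suc i"] by (simp only: mult_zero_right mult_nonneg_nonneg)
    qed
  qed simp
  have growth: "2 * pmf Q 2 * ?a y \<le> (pmf Q 1)\<^sup>2 * ?a (Suc y)" if "?a (Suc y) > 0" for y
  proof -
    have "enat y < N" using that unfolding pos by (simp add: Suc_ile_eq)
    from ratio[OF this] down[OF that] Q1
    have "2 * pmf Q 2 * pmf P y \<le> (pmf Q 1)\<^sup>2 * (real (y + 1) * pmf P (y + 1))"
      by (simp add: field_simps zero_less_mult_iff)
    from mult_right_mono[OF this, of "fact y"] show ?thesis by (simp add: algebra_simps)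
  qed
  let ?c = "pmf (compound Q P)"
  have c_down: "?c x > 0" if "?c (Suc x) > 0" for x
    by (rule mix_support_down[where a = ?a, OF Q1 pmf_nonneg nonneg down
          that[unfolded pmf_compound_eq_mix], folded pmf_compound_eq_mix])
  have "?c x > 0" if "x \<le> z" "?c z > 0" for x z
    using that(1) by (induction x rule: inc_induct) (use that(2) c_down in auto)
  then have "is_nat_interval (set_pmf (compound Q P))"
    unfolding is_nat_interval_def by (auto simp: pmf_positive_iff)
  moreover have "?c (x + 1) * ?c (x - 1) \<le> (?c x)\<^sup>2" if "x \<ge> 1" for x
  proof -
    have "?c (Suc (Suc w)) * ?c w \<le> (?c (Suc w))\<^sup>2" for w
      unfolding pmf_compound_eq_mix
      by (rule mix_log_concave[where a = ?a, OF Q1 pmf_nonneg nonneg lr down growth])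
    from this[of "x - 1"] that show ?thesis by simp
  qed
  ultimately show ?thesis by (simp add: log_concave_def)
qed

end

section \<open>The Poisson case\<close>

lemma pmf_poisson_Suc:
  "l > 0 \<Longrightarrow> real (Suc x) * pmf (poisson_pmf l) (Suc x) = l * pmf (poisson_pmf l) x"
  by (simp add: field_simps del: of_nat_Suc)

text \<open>The ratio \<open>(x + 1) P(x + 1) / P(x)\<close> is constantly \<open>l\<close>, so
  equality holds.\<close>

lemma ultra_log_concave_poisson:
  assumes "l > 0"
  shows "ultra_log_concave (poisson_pmf l)"
proof -
  have "real (x + 1) * pmf (poisson_pmf l) (x + 1) * pmf (poisson_pmf l) (x - 1)
      = real x * (pmf (poisson_pmf l) x)\<^sup>2" if "x \<ge> 1" for x
  proof -
    obtain w where x: "x = Suc w" using \<open>x \<ge> 1\<close> by (cases x) auto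
    have "real (x + 1) * pmf (poisson_pmf l) (x + 1) * pmf (poisson_pmf l) w
        = pmf (poisson_pmf l) x * (l * pmf (poisson_pmf l) w)"
      using pmf_poisson_Suc[OF assms, of x] by simp
    also have "\<dots> = real x * (pmf (poisson_pmf l) x)\<^sup>2"
      unfolding pmf_poisson_Suc[OF assms, symmetric] x by (simp add: power2_eq_square)
    finally show ?thesis by (simp add: x)
  qed
  with assms show ?thesis
    by (simp add: ultra_log_concave_def is_nat_interval_def set_pmf_poisson)
qed

theorem theorem4p2:
  fixes Q :: "nat pmf"
  assumes "set_pmf Q \<subseteq> {1, 2}"
    and "pmf Q 1 > 0"
  shows "(\<forall>l::real. l > 0 \<and> l \<ge> 2 * pmf Q 2 / (pmf Q 1)\<^sup>2
            \<longrightarrow> log_concave (compound_poisson l Q))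
       \<and> (\<forall>(P :: nat pmf) (N :: enat).
            ultra_log_concave P \<and> set_pmf P = {x. enat x \<le> N}
            \<and> (\<forall>x::nat. enat x < N \<longrightarrow>
                 real (x + 1) * pmf P (x + 1) / pmf P x \<ge> 2 * pmf Q 2 / (pmf Q 1)\<^sup>2)
            \<longrightarrow> log_concave (compound Q P))"
proof (intro conjI allI impI; (elim conjE)?)
  fix l :: real
  assume l: "l > 0" "l \<ge> 2 * pmf Q 2 / (pmf Q 1)\<^sup>2"
  \<comment> \<open>Part (i) is thus part (ii) with infinite \<open>N\<close>: the ratio condition
    becomes the bound on \<open>l\<close>.\<close>
  have "real (x + 1) * pmf (poisson_pmf l) (x + 1) / pmf (poisson_pmf l) x = l" for x
  proof -
    have "pmf (poisson_pmf l) x > 0" using l(1) by simp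
    with pmf_poisson_Suc[OF l(1), of x] show ?thesis by (simp add: field_simps del: pmf_poisson)
  qed
  with assms l show "log_concave (compound_poisson l Q)"
    unfolding compound_poisson_def
    by (intro log_concave_compound[where N = \<infinity>] ultra_log_concave_poisson)
       (auto simp: set_pmf_poisson)
next
  fix P :: "nat pmf" and N :: enat
  assume "ultra_log_concave P" "set_pmf P = {x. enat x \<le> N}"
    "\<forall>x. enat x < N \<longrightarrow> real (x + 1) * pmf P (x + 1) / pmf P x \<ge> 2 * pmf Q 2 / (pmf Q 1)\<^sup>2"
  with assms show "log_concave (compound Q P)"
    by (intro log_concave_compound) auto
qed

end
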